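(* Let $G=(V,E)$ be a graph, let $\mathscr{H}$ be the collection of all non-empty subgraphs of $G$, let $w:\mathscr{H}\to\mathbb{R}_+$, and let $\varepsilon>0$. If the weighted graph $G(V,E,w)$ is approximately monotone (with error $\varepsilon$), then there exists a function $\widetilde{w}:\mathscr{H}\to\mathbb{R}_+$ such that $G(V,E,\widetilde{w})$ is a monotone (increasing) graph and $\|w-\widetilde{w}\|\leq \varepsilon/2$. Conversely, if $\widetilde{w}:\mathscr{H}\to\mathbb{R}_+$ is such that $G(V,E,\widetilde{w})$ is a monotone graph and $\|w-\widetilde{w}\|\leq \varepsilon/2$, then $G(V,E,w)$ is approximately monotone (with error $\varepsilon$).
   Context: $\mathbb{R}_+$ denotes the set of positive real numbers. $G=(V,E)$ is a graph with vertex set $V$ and edge set $E$; no restriction is imposed on the cardinalities of $V$ and $E$ (they may be infinite). $\mathscr{H}$ denotes the collection of all non-empty subgraphs of $G$, partially ordered by inclusion $\subseteq$ (the subgraph relation). A weight function is a map $w:\mathscr{H}\to\mathbb{R}_+$ assigning a weight to each subgraph, and $G(V,E,w)$ denotes the corresponding weighted graph. For weight functions $w_1,w_2$, $\|w_1-w_2\|=\sup_{H\in\mathscr{H}}|w_1(H)-w_2(H)|$, so $\|w_1-w_2\|\le c$ means $|w_1(H)-w_2(H)|\le c$ for all $H\in\mathscr{H}$. For fixed $\varepsilon>0$, $G(V,E,w)$ is called approximately monotone (with error $\varepsilon$) if $w(H)\leq w(H')+\varepsilon$ for all $H,H'\in\mathscr{H}$ with $H\subset H'$. It is called monotone (increasing)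 if $w(H)\leq w(H')$ for all $H,H'\in\mathscr{H}$ with $H\subset H'$. *)

theory Defs
  imports Complex_Main "HOL-Library.Product_Order" "HOL-Library.Extended_Nonnegative_Real"
    "HOL-Library.FuncSet"
begin

text \<open>
  An undirected graph is a pair of a vertex set and a set of unordered pairs of vertices; loops are
  permitted, and both sets may be infinite. Graphs are compared by the componentwise inclusion
  order of \<^theory>\<open>HOL-Library.Product_Order\<close>: \<open>H \<le> H'\<close> is the
  subgraph relation and \<open>H < H'\<close> the proper subgraph relation.
\<close>

type_synonym 'v graph = "'v set \<times> 'v set set"

definition verts :: "'v graph \<Rightarrow> 'v set" where
  "verts G = fst G"

definition edges :: "'v graph \<Rightarrow> 'v set set" where
  "edges G = snd G"

definition is_graph :: "'v graph \<Rightarrow> bool" where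
  "is_graph G \<longleftrightarrow> (\<forall>e\<in>edges G. \<exists>u\<in>verts G. \<exists>v\<in>verts G. e = {u, v})"

definition nonempty_subgraphs :: "'v graph \<Rightarrow> 'v graph set" where
  "nonempty_subgraphs G = {H. is_graph H \<and> H \<le> G \<and> verts H \<noteq> {}}"

text \<open>Weights outside \<open>nonempty_subgraphs G\<close> are irrelevant and left unconstrained.\<close>

definition weight_functions :: "'v graph \<Rightarrow> ('v graph \<Rightarrow> real) set" where
  "weight_functions G = nonempty_subgraphs G \<rightarrow> {0<..}"

text \<open>
  The supremum is taken in the extended nonnegative reals since the difference of two weight
  functions may be unbounded. It is 0 for the graph without vertices, which has no nonempty
  subgraph.
\<close>

definition weight_dist :: "'v graph \<Rightarrow> ('v graph \<Rightarrow> real) \<Rightarrow> ('v graph \<Rightarrow> real) \<Rightarrow> ennreal" where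
  "weight_dist G w1 w2 = (SUP H\<in>nonempty_subgraphs G. ennreal \<bar>w1 H - w2 H\<bar>)"

definition approx_monotone :: "'v graph \<Rightarrow> ('v graph \<Rightarrow> real) \<Rightarrow> real \<Rightarrow> bool" where
  "approx_monotone G w \<epsilon> \<longleftrightarrow>
    (\<forall>H\<in>nonempty_subgraphs G. \<forall>H'\<in>nonempty_subgraphs G. H < H' \<longrightarrow> w H \<le> w H' + \<epsilon>)"

definition monotone_weight :: "'v graph \<Rightarrow> ('v graph \<Rightarrow> real) \<Rightarrow> bool" where
  "monotone_weight G w \<longleftrightarrow>
    (\<forall>H\<in>nonempty_subgraphs G. \<forall>H'\<in>nonempty_subgraphs G. H < H' \<longrightarrow> w H \<le> w H')"

end

theory Submission imports Defs begin

text \<open>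
  The monotone weight is the lower envelope \<open>H \<mapsto> inf {w K | K \<supseteq> H}\<close> shifted up by \<open>\<epsilon> / 2\<close>:
  approximate monotonicity keeps the envelope between \<open>w H - \<epsilon>\<close> and \<open>w H\<close>. The analogous upper
  envelope, shifted down by \<open>\<epsilon> / 2\<close>, need not be positive. The converse is the triangle inequality.
\<close>

text \<open>A supremum is bounded exactly when each term is. The sign of \<open>c\<close> matters
  because \<open>ennreal\<close> sends negative reals to 0.\<close>

lemma weight_dist_le_iff:
  assumes "0 \<le> c"
  shows "weight_dist G w1 w2 \<le> ennreal c \<longleftrightarrow> (\<forall>H\<in>nonempty_subgraphs G. \<bar>w1 H - w2 H\<bar> \<le> c)"
  using assms by (simp add: weight_dist_def SUP_le_iff)

definition lower_envelope :: "'v graph \<Rightarrow> ('v graph \<Rightarrow> real) \<Rightarrow> 'v graph \<Rightarrow> real" where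
  "lower_envelope G w H = (INF K\<in>{K \<in> nonempty_subgraphs G. H \<le> K}. w K)"

lemma bdd_below_weight:
  assumes "w \<in> weight_functions G"
  shows "bdd_below (w ` {K \<in> nonempty_subgraphs G. H \<le> K})"
  using assms by (intro bdd_belowI2[where m = 0]) (auto simp: weight_functions_def Pi_iff less_imp_le)

lemma lower_envelope_le:
  assumes "w \<in> weight_functions G" "K \<in> nonempty_subgraphs G" "H \<le> K"
  shows "lower_envelope G w H \<le> w K"
  unfolding lower_envelope_def using assms by (intro cINF_lower bdd_below_weight) auto

lemma lower_envelope_greatest:
  assumes "H \<in> nonempty_subgraphs G"
    and "\<And>K. K \<in> nonempty_subgraphs G \<Longrightarrow> H \<le> K \<Longrightarrow> c \<le> w K"
  shows "c \<le> lower_envelope G w H"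
  unfolding lower_envelope_def using assms by (intro cINF_greatest) blast+

text \<open>Only a weak inequality survives: infinitely many positive weights may have infimum 0.
  The shift by \<open>\<epsilon> / 2\<close> restores strict positivity.\<close>

lemma lower_envelope_nonneg:
  assumes "w \<in> weight_functions G" "H \<in> nonempty_subgraphs G"
  shows "0 \<le> lower_envelope G w H"
  using assms
  by (intro lower_envelope_greatest) (auto simp: weight_functions_def Pi_iff less_imp_le)

text \<open>A larger \<open>H\<close> has fewer supergraphs, so the infimum runs over a smaller
  set.\<close>

lemma monotone_lower_envelope:
  assumes "w \<in> weight_functions G"
  shows "monotone_weight G (lower_envelope G w)"
  unfolding monotone_weight_def
  using assms
  by (intro ballI impI lower_envelope_greatest lower_envelope_le) (assumption | erule order.trans[OF less_imp_le])+

lemma lower_envelope_ge: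
  assumes "approx_monotone G w \<epsilon>" "0 \<le> \<epsilon>" "H \<in> nonempty_subgraphs G"
  shows "w H - \<epsilon> \<le> lower_envelope G w H"
proof (rule lower_envelope_greatest)
  fix K
  assume "K \<in> nonempty_subgraphs G" "H \<le> K"
  with assms show "w H - \<epsilon> \<le> w K"
    \<comment> \<open>Approximate monotonicity speaks of proper inclusions only; for
      \<open>K = H\<close> the bound is \<open>0 \<le> \<epsilon>\<close>.\<close>
    by (cases "H = K") (auto simp: approx_monotone_def diff_le_eq order.strict_iff_order)
qed (use assms in auto)

theorem proposition1p1:
  fixes G :: "'v graph" and w :: "'v graph \<Rightarrow> real" and \<epsilon> :: real
  assumes "is_graph G" and "w \<in> weight_functions G" and "\<epsilon> > 0"
  shows "(approx_monotone G w \<epsilon> \<longrightarrow>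
           (\<exists>w'\<in>weight_functions G.
              monotone_weight G w' \<and> weight_dist G w w' \<le> ennreal (\<epsilon> / 2))) \<and>
         (\<forall>w'\<in>weight_functions G.
            monotone_weight G w' \<and> weight_dist G w w' \<le> ennreal (\<epsilon> / 2) \<longrightarrow>
              approx_monotone G w \<epsilon>)"
proof (intro conjI impI ballI)
  assume am: "approx_monotone G w \<epsilon>"
  define w' where "w' H = lower_envelope G w H + \<epsilon> / 2" for H
  have "w' \<in> weight_functions G"
    using lower_envelope_nonneg[OF assms(2)] assms(3)
    by (auto simp: w'_def weight_functions_def intro!: add_nonneg_pos)
  moreover have "monotone_weight G w'"
    using monotone_lower_envelope[OF assms(2)] by (simp add: monotone_weight_def w'_def)
  moreover have "\<bar>w H - w' H\<bar> \<le> \<epsilon> / 2" if "H \<in> nonempty_subgraphs G" for H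
    \<comment> \<open>The shift centres the range of the envelope, from
      \<open>w H - \<epsilon>\<close> to \<open>w H\<close>, at \<open>w H\<close>.\<close>
    using lower_envelope_ge[OF am _ that] lower_envelope_le[OF assms(2) that order_refl] assms(3)
    unfolding w'_def by linarith
  ultimately show "\<exists>w'\<in>weight_functions G.
      monotone_weight G w' \<and> weight_dist G w w' \<le> ennreal (\<epsilon> / 2)"
    using assms(3) by (auto simp: weight_dist_le_iff)
next
  fix w'
  assume "monotone_weight G w' \<and> weight_dist G w w' \<le> ennreal (\<epsilon> / 2)"
  then have mono: "monotone_weight G w'"
    and close: "\<bar>w H - w' H\<bar> \<le> \<epsilon> / 2" if "H \<in> nonempty_subgraphs G" for H
    using assms(3) that by (auto simp: weight_dist_le_iff)
  show "approx_monotone G w \<epsilon>"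
    unfolding approx_monotone_def
  proof (intro ballI impI)
    fix H H'
    assume H: "H \<in> nonempty_subgraphs G" "H' \<in> nonempty_subgraphs G" "H < H'"
    then have "w' H \<le> w' H'"
      using mono by (simp add: monotone_weight_def)
    \<comment> \<open>Passing from \<open>w\<close> to \<open>w'\<close> at \<open>H\<close> and
      back at \<open>H'\<close> costs \<open>\<epsilon> / 2\<close> each time.\<close>
    then show "w H \<le> w H' + \<epsilon>"
      using close[OF H(1)] close[OF H(2)] by linarith
  qed
qed

end
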